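(* Let $n\ge 2$ be an integer. For all $x,y\in\mathbb{C}\mathbb{Z}_n$ one has $$q_2(x+y)=q_2(x)+q_2(y)+q_1(x)q_1(y)-q_1(xy).$$
   Context: $\mathbb{Z}_n$ is the cyclic group of order $n$, with elements $e_1,\dots,e_n$ where $e_i$ is the class of $i-1$ (so $e_ie_j=e_{i+j-1}$, subscripts mod $n$, and $e_1$ is the identity); $\mathbb{C}\mathbb{Z}_n$ is its complex group algebra. For $c_1,\dots,c_n\in\mathbb{C}$, $\operatorname{circ}(c_1,\dots,c_n)$ is the $n\times n$ circulant matrix whose $(i,j)$ entry is $c_{j-i+1}$ (subscripts mod $n$). For $x=c_1e_1+\dots+c_ne_n\in\mathbb{C}\mathbb{Z}_n$ the scalars $q_1(x),\dots,q_n(x)$ are defined by the characteristic polynomial $$\det\big(X I_n-\operatorname{circ}(c_1,\dots,c_n)\big)=X^n-q_1(x)X^{n-1}+q_2(x)X^{n-2}-\dots+(-1)^nq_n(x).$$ *)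

theory Defs
  imports
    "HOL-Library.Poly_Mapping"
    "Berlekamp_Zassenhaus.Finite_Field"
    "Jordan_Normal_Form.Char_Poly"
begin

text \<open>
  The cyclic group of order \<open>n\<close> is the additive group of \<open>'n mod_ring\<close>, where \<open>n = CARD('n)\<close>.
  Its complex group algebra is the type of finitely supported functions
  \<open>'n mod_ring \<Rightarrow>\<^sub>0 complex\<close>: addition is pointwise and multiplication is convolution, so that
  \<open>single a 1 * single b 1 = single (a + b) 1\<close>.
\<close>

type_synonym 'n cyclic_algebra = "'n mod_ring \<Rightarrow>\<^sub>0 complex"

definition basis_elt :: "nat \<Rightarrow> 'n::finite cyclic_algebra" where
  "basis_elt i = Poly_Mapping.single (of_int_mod_ring (int i - 1)) 1"

definition coord :: "'n::finite cyclic_algebra \<Rightarrow> nat \<Rightarrow> complex" where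
  "coord x i = Poly_Mapping.lookup x (of_int_mod_ring (int i - 1))"

text \<open>
  The sequence \<open>c\<close> is indexed from \<open>1\<close> to \<open>n\<close>, but matrix positions are counted from \<open>0\<close>; the
  shift of both matrix indices cancels in \<open>j - i\<close>, and \<open>(j - i) mod n + 1\<close> is the representative
  of \<open>j - i + 1\<close> modulo \<open>n\<close> in the range from \<open>1\<close> to \<open>n\<close>.
\<close>

definition circ :: "nat \<Rightarrow> (nat \<Rightarrow> complex) \<Rightarrow> complex mat" where
  "circ n c = mat n n (\<lambda>(i, j). c (nat ((int j - int i) mod int n) + 1))"

text \<open>
  Only \<open>k \<le> CARD('n)\<close> is meaningful, because of the truncated subtraction.  The lemma
  \<open>char_poly_circ_eq\<close> below is the expansion that characterises these scalars.
\<close>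

definition q :: "nat \<Rightarrow> 'n::finite cyclic_algebra \<Rightarrow> complex" where
  "q k x = (-1) ^ k * coeff (char_poly (circ CARD('n) (coord x))) (CARD('n) - k)"

lemma char_poly_circ_eq:
  fixes x :: "'n::finite cyclic_algebra"
  shows "char_poly (circ CARD('n) (coord x))
    = (\<Sum>k\<le>CARD('n). monom ((-1) ^ k * q k x) (CARD('n) - k))"
proof -
  let ?p = "char_poly (circ CARD('n) (coord x))"
  have "circ CARD('n) (coord x) \<in> carrier_mat CARD('n) CARD('n)"
    by (simp add: circ_def)
  then have d: "degree ?p = CARD('n)"
    using degree_monic_char_poly by blast
  have "?p = (\<Sum>i\<le>CARD('n). monom (coeff ?p i) i)"
    using poly_as_sum_of_monoms[of ?p] d by simp
  also have "\<dots> = (\<Sum>k\<le>CARD('n). monom (coeff ?p (CARD('n) - k)) (CARD('n) - k))"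
    using sum.nat_diff_reindex[of "\<lambda>i. monom (coeff ?p i) i" "Suc CARD('n)"]
    by (simp only: lessThan_Suc_atMost diff_Suc_Suc)
  also have "\<dots> = (\<Sum>k\<le>CARD('n). monom ((-1) ^ k * q k x) (CARD('n) - k))"
    by (intro sum.cong refl) (simp add: q_def minus_one_power_iff)
  finally show ?thesis .
qed

lemma of_int_mod_ring_plus:
  "(of_int_mod_ring a + of_int_mod_ring b :: 'n::finite mod_ring) = of_int_mod_ring (a + b)"
  by transfer (simp add: mod_simps)

lemma basis_elt_1: "basis_elt 1 = 1"
  by (simp add: basis_elt_def)

lemma basis_elt_mult:
  assumes "i \<ge> 1" "j \<ge> 1"
  shows "basis_elt i * basis_elt j = basis_elt (i + j - 1)"
  using assms by (simp add: basis_elt_def mult_single of_int_mod_ring_plus of_nat_diff algebra_simps)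

lemma basis_elt_cong: "basis_elt (i + CARD('n)) = (basis_elt i :: 'n::finite cyclic_algebra)"
proof -
  have "(of_int_mod_ring (int (i + CARD('n)) - 1) :: 'n mod_ring) = of_int_mod_ring (int i - 1)"
  proof transfer
    fix i :: nat
    show "(int (i + CARD('n)) - 1) mod int CARD('n) = (int i - 1) mod int CARD('n)"
      using mod_add_self2[of "int i - 1" "int CARD('n)"] by (simp add: algebra_simps)
  qed
  then show ?thesis by (simp add: basis_elt_def)
qed

lemma sum_coord_basis_elt:
  fixes x :: "'n::finite cyclic_algebra"
  shows "x = (\<Sum>i = 1..CARD('n). Poly_Mapping.single 0 (coord x i) * basis_elt i)"
proof (rule poly_mapping_eqI)
  fix a :: "'n mod_ring"
  let ?f = "\<lambda>i::nat. of_int_mod_ring (int i - 1) :: 'n mod_ring"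
  let ?i = "nat (to_int_mod_ring a) + 1"
  have a: "0 \<le> to_int_mod_ring a" "to_int_mod_ring a < int CARD('n)"
    using range_to_int_mod_ring[where 'a='n] by (metis atLeastLessThan_iff rangeI)+
  have eq: "?f i = a \<longleftrightarrow> i = ?i" if "i \<in> {1..CARD('n)}" for i
  proof
    assume "?f i = a"
    then have "to_int_mod_ring a = int i - 1"
      using that to_int_mod_ring_of_int_mod_ring[of "int i - 1", where 'a='n] by auto
    then show "i = ?i" using that by auto
  qed (use a in simp)
  have "Poly_Mapping.lookup (\<Sum>i = 1..CARD('n). Poly_Mapping.single 0 (coord x i) * basis_elt i) a
      = (\<Sum>i = 1..CARD('n). coord x i when ?f i = a)"
    by (simp add: lookup_sum basis_elt_def mult_single lookup_single)
  also have "\<dots> = (\<Sum>i = 1..CARD('n). if i = ?i then coord x i else 0)"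
    by (rule sum.cong) (use eq in \<open>auto simp: when_def\<close>)
  also have "\<dots> = coord x ?i"
    using a by (subst sum.delta) auto
  also have "\<dots> = Poly_Mapping.lookup x a"
    using a by (simp add: coord_def)
  finally show "Poly_Mapping.lookup x a
    = Poly_Mapping.lookup (\<Sum>i = 1..CARD('n). Poly_Mapping.single 0 (coord x i) * basis_elt i) a" ..
qed

end

theory Submission
  imports Defs "Jordan_Normal_Form.Schur_Decomposition"
begin

text \<open>
  The identity is the polarisation of Newton's identity \<open>2 e\<^sub>2 = e\<^sub>1\<^sup>2 - p\<^sub>2\<close> between elementary
  symmetric polynomials and power sums.  Up to sign, \<open>q\<^sub>1\<close> and \<open>q\<^sub>2\<close> are leading coefficients of
  a characteristic polynomial, so by Vieta's formulas they are \<open>e\<^sub>1\<close> and \<open>e\<^sub>2\<close> of the eigenvalues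
  of the circulant.  A complex matrix \<open>A\<close> is similar to an upper triangular one with the
  eigenvalues on the diagonal (Schur), whence \<open>e\<^sub>1 = tr A\<close> and \<open>p\<^sub>2 = tr (A\<^sup>2)\<close>
  (\<open>char_poly_coeffs_trace\<close>).

  Sending \<open>x\<close> to its circulant matrix is the regular representation of the group algebra, so it is
  additive and multiplicative (\<open>circ_coord_add\<close>, \<open>circ_coord_mult\<close>).  Thus \<open>q\<^sub>1\<close>, being a trace,
  is additive, the trace of the square is \<open>q\<^sub>1 (x\<^sup>2)\<close>, and Newton's identity reads
  \<open>2 q\<^sub>2 x = (q\<^sub>1 x)\<^sup>2 - q\<^sub>1 (x\<^sup>2)\<close> (\<open>q_2_newton\<close>).  The right-hand side is a quadratic form in \<open>x\<close>.
  As the group algebra is commutative, its polar form at \<open>x\<close> and \<open>y\<close> is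
  \<open>2 q\<^sub>1 x q\<^sub>1 y - 2 q\<^sub>1 (x y)\<close>, and halving gives the claim.
\<close>

section \<open>Traces\<close>

definition mat_trace :: "'a::comm_ring_1 mat \<Rightarrow> 'a" where
  "mat_trace A = (\<Sum>i<dim_row A. A $$ (i, i))"

lemma mat_trace_add:
  assumes "A \<in> carrier_mat n n" "B \<in> carrier_mat n n"
  shows "mat_trace (A + B) = mat_trace A + mat_trace B"
  using assms by (simp add: mat_trace_def sum.distrib)

lemma mat_trace_mult:
  assumes "A \<in> carrier_mat n m" "B \<in> carrier_mat m n"
  shows "mat_trace (A * B) = (\<Sum>i<n. \<Sum>j<m. A $$ (i, j) * B $$ (j, i))"
  using assms by (simp add: mat_trace_def scalar_prod_def atLeast0LessThan)

lemma mat_trace_mult_commute: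
  assumes "A \<in> carrier_mat n m" "B \<in> carrier_mat m n"
  shows "mat_trace (A * B) = mat_trace (B * A)"
  unfolding mat_trace_mult[OF assms] mat_trace_mult[OF assms(2,1)]
  by (subst sum.swap) (simp add: mult.commute)

lemma mat_trace_similar:
  assumes "similar_mat_wit A B P Q"
  shows "mat_trace A = mat_trace B"
proof -
  obtain n where n: "A \<in> carrier_mat n n" by (meson assms similar_mat_witD)
  note w = similar_mat_witD2[OF n assms]
  have "mat_trace A = mat_trace (Q * (P * B))"
    using w mat_trace_mult_commute[of "P * B" n n Q] by simp
  also have "Q * (P * B) = B"
    using w assoc_mult_mat[of Q n n P n B n] by simp
  finally show ?thesis .
qed

lemma mat_trace_diag:
  "mat_trace A = sum_list (diag_mat A)"
  by (simp add: mat_trace_def diag_mat_def interv_sum_list_conv_sum_set_nat atLeast0LessThan)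

text \<open>
  The \<open>i\<close>-th diagonal entry of \<open>A\<^sup>2\<close> is the sum of \<open>A\<^sub>i\<^sub>j A\<^sub>j\<^sub>i\<close> over \<open>j\<close>; when \<open>i \<noteq> j\<close>, one of
  the two positions lies strictly below the diagonal.
\<close>

lemma mat_trace_upper_triangular_square:
  assumes A: "A \<in> carrier_mat n n" and ut: "upper_triangular A"
  shows "mat_trace (A * A) = (\<Sum>a\<leftarrow>diag_mat A. a\<^sup>2)"
proof -
  have "(\<Sum>j<n. A $$ (i, j) * A $$ (j, i)) = (A $$ (i, i))\<^sup>2" if i: "i < n" for i
  proof -
    have "A $$ (i, j) * A $$ (j, i) = (if j = i then (A $$ (i, i))\<^sup>2 else 0)" if "j < n" for j
    proof (cases j i rule: linorder_cases)
      case less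
      then show ?thesis using A ut i by (auto simp: upper_triangular_def)
    next
      case greater
      then show ?thesis using A ut that by (auto simp: upper_triangular_def)
    qed (simp add: power2_eq_square)
    then have "(\<Sum>j<n. A $$ (i, j) * A $$ (j, i))
        = (\<Sum>j<n. if j = i then (A $$ (i, i))\<^sup>2 else 0)"
      by (intro sum.cong) auto
    then show ?thesis using i by simp
  qed
  then show ?thesis
    unfolding mat_trace_mult[OF A A] using A
    by (simp add: diag_mat_def interv_sum_list_conv_sum_set_nat atLeast0LessThan)
qed

section \<open>Leading coefficients of the characteristic polynomial\<close>

lemma coeff_linear_mult_Suc:
  fixes p :: "'a::comm_ring_1 poly"
  shows "coeff ([:- a, 1:] * p) (Suc k) = coeff p k - a * coeff p (Suc k)"
  by simp

lemma coeff_prod_linear_top: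
  fixes as :: "'a::idom list"
  shows "coeff (\<Prod>a\<leftarrow>as. [:- a, 1:]) (length as) = 1"
proof -
  have "monic (\<Prod>a\<leftarrow>as. [:- a, 1:])"
    by (rule monic_prod_list) auto
  then show ?thesis
    by (simp add: degree_linear_factors)
qed

lemma coeff_prod_linear_second:
  fixes as :: "'a::idom list"
  assumes "length as = Suc k"
  shows "coeff (\<Prod>a\<leftarrow>as. [:- a, 1:]) k = - sum_list as"
  using assms
proof (induction as arbitrary: k)
  case (Cons a as)
  show ?case
  proof (cases k)
    case 0
    with Cons.prems show ?thesis by simp
  next
    case (Suc l)
    with Cons.prems have "length as = Suc l" by simp
    then show ?thesis
      using Suc Cons.IH coeff_prod_linear_top[of as]
      by (simp add: coeff_linear_mult_Suc del: mult_pCons_left)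
  qed
qed simp

text \<open>
  The coefficient is the sum of the products of the roots over all pairs of positions.  Multiplying
  out the square of the sum gives each of these products twice, besides the squares; the factor 2
  on the left avoids both a sum over pairs and a division.
\<close>

lemma coeff_prod_linear_third:
  fixes as :: "'a::idom list"
  assumes "length as = Suc (Suc k)"
  shows "2 * coeff (\<Prod>a\<leftarrow>as. [:- a, 1:]) k = (sum_list as)\<^sup>2 - (\<Sum>a\<leftarrow>as. a\<^sup>2)"
  using assms
proof (induction as arbitrary: k)
  case (Cons a as)
  show ?case
  proof (cases k)
    case 0
    with Cons.prems obtain b where "as = [b]" by (auto simp: length_Suc_conv)
    with 0 show ?thesis by (simp add: power2_eq_square algebra_simps)
  next
    case (Suc l)
    with Cons.prems have len: "length as = Suc (Suc l)" by simp
    let ?p = "\<Prod>a\<leftarrow>as. [:- a, 1:]"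
    have "2 * coeff (\<Prod>a\<leftarrow>a # as. [:- a, 1:]) k = 2 * coeff ?p l - a * (2 * coeff ?p (Suc l))"
      using Suc by (simp add: coeff_linear_mult_Suc algebra_simps del: mult_pCons_left)
    also have "\<dots> = (sum_list as)\<^sup>2 - (\<Sum>a\<leftarrow>as. a\<^sup>2) + 2 * a * sum_list as"
      using Cons.IH[OF len] coeff_prod_linear_second[OF len] by simp
    finally show ?thesis by (simp add: power2_eq_square algebra_simps)
  qed
qed simp

lemma char_poly_coeffs_trace:
  fixes A :: "complex mat"
  assumes A: "A \<in> carrier_mat n n"
  shows "n = Suc k \<Longrightarrow> coeff (char_poly A) k = - mat_trace A"
    and "n = Suc (Suc k) \<Longrightarrow> 2 * coeff (char_poly A) k = (mat_trace A)\<^sup>2 - mat_trace (A * A)"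
proof -
  obtain as where as: "char_poly A = (\<Prod>a\<leftarrow>as. [:- a, 1:])" "length as = n"
    using char_poly_factorized[OF A] by blast
  obtain B P Q where "schur_decomposition A as = (B, P, Q)"
    by (cases "schur_decomposition A as")
  from schur_decomposition[OF A as(1) this]
  have sim: "similar_mat_wit A B P Q" and ut: "upper_triangular B" and diag: "diag_mat B = as"
    by auto
  have B: "B \<in> carrier_mat n n"
    using similar_mat_witD2[OF A sim] by blast
  have "similar_mat_wit (A * A) (B * B) P Q"
    using similar_mat_wit_pow[OF sim, of 2] A B by (simp add: numeral_2_eq_2)
  then have sq: "mat_trace (A * A) = (\<Sum>a\<leftarrow>as. a\<^sup>2)"
    using mat_trace_similar mat_trace_upper_triangular_square[OF B ut] diag by metis
  have tr: "mat_trace A = sum_list as"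
    using mat_trace_similar[OF sim] mat_trace_diag[of B] diag by simp
  show "coeff (char_poly A) k = - mat_trace A" if "n = Suc k"
    using coeff_prod_linear_second as that tr by metis
  show "2 * coeff (char_poly A) k = (mat_trace A)\<^sup>2 - mat_trace (A * A)" if "n = Suc (Suc k)"
    using coeff_prod_linear_third as that tr sq by metis
qed

section \<open>Circulants as the regular representation\<close>

lemma of_int_mod_ring_mod:
  "(of_int_mod_ring (a mod int CARD('n)) :: 'n::finite mod_ring) = of_int_mod_ring a"
  by transfer simp

lemma of_int_mod_ring_minus:
  "(of_int_mod_ring (a - b) :: 'n::finite mod_ring) = of_int_mod_ring a - of_int_mod_ring b"
  by transfer (simp add: mod_simps)

lemma bij_betw_of_int_mod_ring:
  "bij_betw (\<lambda>k. of_int_mod_ring (int k)) {..<CARD('n)} (UNIV :: 'n::finite mod_ring set)"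
proof (rule bij_betw_byWitness[where f' = "\<lambda>a. nat (to_int_mod_ring a)"])
  have "0 \<le> to_int_mod_ring a \<and> to_int_mod_ring a < int CARD('n)" for a :: "'n mod_ring"
    using range_to_int_mod_ring[where 'a = 'n] by (metis atLeastLessThan_iff rangeI)
  then show "\<forall>a\<in>(UNIV :: 'n mod_ring set). of_int_mod_ring (int (nat (to_int_mod_ring a))) = a"
    and "(\<lambda>a. nat (to_int_mod_ring a)) ` (UNIV :: 'n mod_ring set) \<subseteq> {..<CARD('n)}"
    by (auto simp: nat_less_iff)
qed auto

lemma circ_carrier [simp]: "circ n c \<in> carrier_mat n n"
  by (simp add: circ_def)

lemma circ_coord_index:
  fixes x :: "'n::finite cyclic_algebra"
  assumes "i < CARD('n)" "j < CARD('n)"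
  shows "circ CARD('n) (coord x) $$ (i, j)
    = Poly_Mapping.lookup x (of_int_mod_ring (int j) - of_int_mod_ring (int i))"
  using assms by (simp add: circ_def coord_def of_int_mod_ring_mod of_int_mod_ring_minus)

lemma circ_coord_add:
  fixes x y :: "'n::finite cyclic_algebra"
  shows "circ CARD('n) (coord (x + y)) = circ CARD('n) (coord x) + circ CARD('n) (coord y)"
  by (rule eq_matI) (simp_all add: circ_def coord_def lookup_add)

lemma lookup_mult_group:
  fixes x y :: "'g::{finite, ab_group_add} \<Rightarrow>\<^sub>0 'a::semiring_0"
  shows "Poly_Mapping.lookup (x * y) c
    = (\<Sum>a\<in>UNIV. Poly_Mapping.lookup x a * Poly_Mapping.lookup y (c - a))"
proof -
  have "(\<Sum>b. Poly_Mapping.lookup y b when c = a + b) = Poly_Mapping.lookup y (c - a)" for a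
  proof -
    have "(c = a + b) = (b = c - a)" for b by (auto simp: algebra_simps)
    then show ?thesis by simp
  qed
  then show ?thesis
    by (simp add: lookup_mult Sum_any.expand_superset[of UNIV])
qed

text \<open>
  Both sides are the convolution of the coefficient functions: the substitution \<open>a = k - i\<close> turns
  the sum of \<open>x\<^sub>k\<^sub>-\<^sub>i y\<^sub>j\<^sub>-\<^sub>k\<close> over \<open>k\<close> into the coefficient of \<open>x y\<close> at \<open>j - i\<close>.
\<close>

lemma circ_coord_mult:
  fixes x y :: "'n::finite cyclic_algebra"
  shows "circ CARD('n) (coord (x * y)) = circ CARD('n) (coord x) * circ CARD('n) (coord y)"
    (is "?C (x * y) = ?C x * ?C y")
proof (rule eq_matI)
  fix i j
  assume "i < dim_row (?C x * ?C y)" "j < dim_col (?C x * ?C y)"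
  then have ij: "i < CARD('n)" "j < CARD('n)" by (simp_all add: circ_def)
  let ?r = "\<lambda>k. of_int_mod_ring (int k) :: 'n mod_ring"
  let ?f = "\<lambda>a. Poly_Mapping.lookup x (a - ?r i) * Poly_Mapping.lookup y (?r j - a)"
  have "(?C x * ?C y) $$ (i, j) = (\<Sum>k<CARD('n). ?C x $$ (i, k) * ?C y $$ (k, j))"
    using ij by (simp add: scalar_prod_def atLeast0LessThan carrier_matD[OF circ_carrier])
  also have "\<dots> = (\<Sum>k<CARD('n). ?f (?r k))"
    using ij by (intro sum.cong) (simp_all add: circ_coord_index)
  also have "\<dots> = (\<Sum>a\<in>UNIV. ?f a)"
    by (rule sum.reindex_bij_betw[OF bij_betw_of_int_mod_ring])
  also have "\<dots> = (\<Sum>a\<in>UNIV. Poly_Mapping.lookup x a * Poly_Mapping.lookup y (?r j - ?r i - a))"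
    by (rule sum.reindex_bij_witness[of _ "\<lambda>a. a + ?r i" "\<lambda>a. a - ?r i"])
      (simp_all add: algebra_simps)
  also have "\<dots> = ?C (x * y) $$ (i, j)"
    using ij by (simp add: circ_coord_index lookup_mult_group)
  finally show "?C (x * y) $$ (i, j) = (?C x * ?C y) $$ (i, j)" ..
qed (simp_all add: circ_def)

section \<open>The polarised Newton identity\<close>

lemma q_1_trace:
  fixes x :: "'n::finite cyclic_algebra"
  shows "q 1 x = mat_trace (circ CARD('n) (coord x))"
  using char_poly_coeffs_trace(1)[OF circ_carrier, of "CARD('n)" "CARD('n) - 1" "coord x"]
  by (simp add: q_def)

lemma q_2_newton:
  fixes x :: "'n::finite cyclic_algebra"
  assumes "CARD('n) \<ge> 2"
  shows "2 * q 2 x = (q 1 x)\<^sup>2 - q 1 (x * x)"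
  using char_poly_coeffs_trace(2)[OF circ_carrier, of "CARD('n)" "CARD('n) - 2" "coord x"] assms
  unfolding q_1_trace circ_coord_mult by (simp add: q_def)

lemma q_1_add:
  fixes x y :: "'n::finite cyclic_algebra"
  shows "q 1 (x + y) = q 1 x + q 1 y"
  unfolding q_1_trace circ_coord_add by (rule mat_trace_add[OF circ_carrier circ_carrier])

theorem proposition2p10:
  fixes x y :: "'n::finite cyclic_algebra"
  assumes "CARD('n) \<ge> 2"
  shows "q 2 (x + y) = q 2 x + q 2 y + q 1 x * q 1 y - q 1 (x * y)"
proof -
  have "2 * q 2 (x + y)
      = (q 1 x + q 1 y)\<^sup>2 - (q 1 (x * x) + q 1 (x * y) + (q 1 (x * y) + q 1 (y * y)))"
    unfolding q_2_newton[OF assms] q_1_add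
    by (simp only: distrib_left distrib_right q_1_add mult.commute[of y x] ac_simps)
  also have "\<dots> = 2 * (q 2 x + q 2 y + q 1 x * q 1 y - q 1 (x * y))"
    using q_2_newton[OF assms, of x] q_2_newton[OF assms, of y]
    by (simp only: power2_sum distrib_left right_diff_distrib) simp
  finally show ?thesis by (rule mult_left_cancel[THEN iffD1, rotated]) simp
qed

end
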